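(* For every $1\le i\le r$, the operators $\mathcal{D}_i$ and $\mathcal{T}_i$ on $\mathcal{K}$ satisfy the following quadratic relations: (i) $\mathcal{D}_i^2=\mathcal{D}_i$; (ii) $\mathcal{T}_i^2=(v-1)\mathcal{T}_i+v$.
   Context: Root data. $\Phi$ is an irreducible reduced root system of rank $r$ with Weyl group $W$, simple roots $\alpha_1,\dots,\alpha_r$ and simple reflections $\sigma_i=\sigma_{\alpha_i}$. $\Lambda$ is a lattice (free abelian group of finite rank) containing $\Phi$, on which $W$ acts compatibly with its action on $\Phi$; $Q:\Lambda\to\mathbb{Z}$ is a $W$-invariant quadratic form with $B(\alpha,\beta)=Q(\alpha+\beta)-Q(\alpha)-Q(\beta)$; $Q(\alpha)\neq0$ for $\alpha\in\Phi$, and $\sigma_i\lambda=\lambda-\frac{B(\lambda,\alpha_i)}{Q(\alpha_i)}\alpha_i$ with $\frac{B(\lambda,\alpha_i)}{Q(\alpha_i)}\in\mathbb{Z}$ for all $\lambda\in\Lambda$. Fix an integer $n\ge1$. Put $m(\alpha)=n/\gcd(n,Q(\alpha))$ for $\alpha\in\Phi$, and $\Lambda_0=\{\lambda\in\Lambda: B(\alpha,\lambda)\equiv0 \bmod n\text{ for all simple roots }\alpha\}$ (then $m(\alpha)\alpha\in\Lambda_0$). $\mathcal{K}$ is the fraction field of the group algebra $\mathbb{C}[\Lambda]$ (with basis $x^\lambda$). The permutation action $(w,f)\mapsto w.f$ of $W$ on $\mathcal{K}$ is by field automorphisms with $w.x^\lambda=x^{w\lambda}$. Each character $\xi$ of $\Lambda/\Lambda_0$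 acts on $\mathcal{K}$ by the field automorphism $x^\lambda\mapsto\xi(\bar\lambda)x^\lambda$; put $\mathcal{K}_{\bar\lambda}=\{f:\xi(f)=\xi(\bar\lambda)f\ \forall\xi\}$, so $\mathcal{K}=\bigoplus_{\bar\lambda\in\Lambda/\Lambda_0}\mathcal{K}_{\bar\lambda}$. Parameters: nonzero complex numbers $v,g_0,\dots,g_{n-1}$ with $g_0=-1$ and $g_ig_{n-i}=v^{-1}$ for $1\le i\le n-1$; $g_j$ for any integer $j$ depends only on $j\bmod n$. For a positive integer $m$, $r_m(j)\in\{0,\dots,m-1\}$ is the remainder of $j$ on division by $m$. Metaplectic action. For $f\in\mathcal{K}_{\bar\lambda}$ (any lift $\lambda$), $$\sigma_i(f)=\frac{\sigma_i.f}{1-vx^{m(\alpha_i)\alpha_i}}\Bigl[x^{-r_{m(\alpha_i)}\left(-\frac{B(\lambda,\alpha_i)}{Q(\alpha_i)}\right)\alpha_i}(1-v)-v\,g_{Q(\alpha_i)-B(\lambda,\alpha_i)}\,x^{(1-m(\alpha_i))\alpha_i}(1-x^{m(\alpha_i)\alpha_i})\Bigr],$$ extended additively to $\mathcal{K}$. It is known that this extends to a ($\mathbb{C}$-linear, generally not multiplicative) action $(w,f)\mapsto w(f)$ of $W$ on $\mathcal{K}$. Demazure and Demazure-Lusztig operators, with $\sigma_i(f)$ the metaplectic action: $$\mathcal{D}_i(f)=\frac{f-x^{m(\alpha_i)\alpha_i}\sigma_i(f)}{1-x^{m(\alpha_i)\alpha_i}},\qquad \mathcal{T}_i(f)=(1-v\,x^{m(\alpha_i)\alpha_i})\,\mathcal{D}_i(f)-f.$$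 *)

theory Defs
  imports
    "HOL-Analysis.Analysis"
    "HOL-Library.Poly_Mapping"
    "HOL-Computational_Algebra.Fraction_Field"
    "HOL-Number_Theory.Cong"
begin

section \<open>Lattices: free abelian groups of finite rank\<close>

definition (in ab_group_add) zscale :: "int \<Rightarrow> 'a \<Rightarrow> 'a" (infixr "*\<^sub>Z" 75)
  where "k *\<^sub>Z x = (if 0 \<le> k then ((+) x ^^ nat k) 0 else - (((+) x ^^ nat (- k)) 0))"

class free_ab_group = ab_group_add +
  assumes ex_finite_basis:
    "\<exists>B. finite B \<and> (\<forall>x. \<exists>!c. (\<forall>b. b \<notin> B \<longrightarrow> c b = (0::int)) \<and> x = (\<Sum>b\<in>B. c b *\<^sub>Z b))"

lemma zscale_0 [simp]: "0 *\<^sub>Z x = (0::'a::ab_group_add)"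
  by (simp add: zscale_def)

lemma zscale_succ: "(k + 1) *\<^sub>Z x = k *\<^sub>Z x + (x::'a::ab_group_add)"
proof (cases "0 \<le> k")
  case True
  then have "nat (k + 1) = Suc (nat k)" by simp
  with True show ?thesis by (simp add: zscale_def add.commute)
next
  case False
  then have *: "nat (- k) = Suc (nat (- (k + 1)))" by simp
  show ?thesis
  proof (cases "k = -1")
    case True
    then show ?thesis by (simp add: zscale_def)
  next
    case False2: False
    with False have "\<not> 0 \<le> k + 1" by simp
    with False show ?thesis unfolding zscale_def * by simp
  qed
qed

lemma zscale_add_left: "(j + k) *\<^sub>Z x = j *\<^sub>Z x + k *\<^sub>Z (x::'a::ab_group_add)"
proof (induction k rule: int_induct[where k = 0])
  case base
  then show ?case by simp
next
  case (step1 i)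
  then show ?case
    using zscale_succ[of "j + i" x] zscale_succ[of i x] by (simp add: algebra_simps)
next
  case (step2 i)
  then show ?case
    using zscale_succ[of "j + i - 1" x] zscale_succ[of "i - 1" x] by (simp add: algebra_simps)
qed

text \<open>The next lemma only serves to show that group algebras of lattices have no zero divisors:
  a lattice embeds in an ordered group.\<close>

lemma ex_ordered_embedding:
  "\<exists>h :: 'l::free_ab_group \<Rightarrow> (nat \<Rightarrow>\<^sub>0 int). inj h \<and> (\<forall>x y. h (x + y) = h x + h y)"
proof -
  obtain B :: "'l set" where B: "finite B"
    "\<And>x. \<exists>!c. (\<forall>b. b \<notin> B \<longrightarrow> c b = (0::int)) \<and> x = (\<Sum>b\<in>B. c b *\<^sub>Z b)"
    using ex_finite_basis by blast
  define P where "P x c \<longleftrightarrow> (\<forall>b. b \<notin> B \<longrightarrow> c b = (0::int)) \<and> x = (\<Sum>b\<in>B. c b *\<^sub>Z b)"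
    for x and c :: "'l \<Rightarrow> int"
  have ex1: "\<exists>!c. P x c" for x
    unfolding P_def by (rule B(2))
  then obtain c where c': "\<And>x. P x (c x)"
    by metis
  then have c: "c x b = 0" if "b \<notin> B" for x b
    using that by (simp add: P_def)
  have c_inj: "x = y" if "c x = c y" for x y
    using c'[of x] c'[of y] that unfolding P_def by metis
  have c_add: "c (x + y) = (\<lambda>b. c x b + c y b)" for x y
  proof -
    have "P (x + y) (\<lambda>b. c x b + c y b)"
      using c'[of x] c'[of y] by (simp add: P_def zscale_add_left sum.distrib)
    with ex1 c' show ?thesis by blast
  qed
  obtain e :: "'l \<Rightarrow> nat" where e: "inj_on e B"
    using B(1) finite_imp_inj_to_nat_seg by metis
  define h where "h x = (\<Sum>b\<in>B. Poly_Mapping.single (e b) (c x b))" for x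
  have lk: "Poly_Mapping.lookup (h x) (e b) = c x b" if "b \<in> B" for x b
  proof -
    have "Poly_Mapping.lookup (h x) (e b) = (\<Sum>b'\<in>B. if b' = b then c x b' else 0)"
      unfolding h_def lookup_sum
      by (rule sum.cong) (use e that in \<open>auto simp: lookup_single when_def inj_on_def\<close>)
    also have "\<dots> = c x b" using B(1) that by simp
    finally show ?thesis .
  qed
  have "inj h"
  proof
    fix x y assume "h x = h y"
    then have "c x b = c y b" for b
      using lk[of b x] lk[of b y] c[of b] by (cases "b \<in> B") auto
    then have "c x = c y" ..
    then show "x = y" by (rule c_inj)
  qed
  moreover have "h (x + y) = h x + h y" for x y
    by (simp add: h_def c_add single_add sum.distrib)
  ultimately show ?thesis by blast
qed

section \<open>The group algebra and its field of fractions\<close>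

lemma sum_single_keys:
  fixes f :: "'a \<Rightarrow>\<^sub>0 'b::comm_monoid_add"
  shows "(\<Sum>k\<in>Poly_Mapping.keys f. Poly_Mapping.single k (Poly_Mapping.lookup f k)) = f"
  by (rule poly_mapping_eqI) (auto simp: lookup_sum lookup_single when_def in_keys_iff)

lemma group_algebra_no_zero_divisors:
  fixes f g :: "'l::free_ab_group \<Rightarrow>\<^sub>0 complex"
  assumes "f \<noteq> 0" "g \<noteq> 0"
  shows "f * g \<noteq> 0"
proof
  assume fg: "f * g = 0"
  obtain h :: "'l \<Rightarrow> (nat \<Rightarrow>\<^sub>0 int)" where h: "inj h" "\<And>x y. h (x + y) = h x + h y"
    using ex_ordered_embedding by blast
  define F where "F p = (\<Sum>k\<in>Poly_Mapping.keys p. Poly_Mapping.single (h k) (Poly_Mapping.lookup p k))"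
    for p :: "'l \<Rightarrow>\<^sub>0 complex"
  have F_super: "F p = (\<Sum>k\<in>A. Poly_Mapping.single (h k) (Poly_Mapping.lookup p k))"
    if "finite A" "Poly_Mapping.keys p \<subseteq> A" for p A
    unfolding F_def by (rule sum.mono_neutral_left) (use that in \<open>auto simp: in_keys_iff\<close>)
  have F_add: "F (p + q) = F p + F q" for p q
  proof -
    let ?A = "Poly_Mapping.keys p \<union> Poly_Mapping.keys q"
    have "Poly_Mapping.keys (p + q) \<subseteq> ?A" by (rule keys_add)
    then show ?thesis
      by (simp add: F_super[of ?A] lookup_add single_add sum.distrib)
  qed
  have F_0: "F 0 = 0" by (simp add: F_def)
  have F_sum: "F (sum p A) = (\<Sum>a\<in>A. F (p a))" for p and A :: "'l set"
    by (induction A rule: infinite_finite_induct) (simp_all add: F_0 F_add)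
  have F_single: "F (Poly_Mapping.single k a) = Poly_Mapping.single (h k) a" for k a
    using F_super[of "{k}" "Poly_Mapping.single k a"] by simp
  have F_mult: "F (p * q) = F p * F q" for p q
  proof -
    have "F (p * q) = F ((\<Sum>k\<in>Poly_Mapping.keys p. Poly_Mapping.single k (Poly_Mapping.lookup p k)) *
                         (\<Sum>l\<in>Poly_Mapping.keys q. Poly_Mapping.single l (Poly_Mapping.lookup q l)))"
      by (simp only: sum_single_keys)
    also have "\<dots> = (\<Sum>k\<in>Poly_Mapping.keys p. \<Sum>l\<in>Poly_Mapping.keys q.
        Poly_Mapping.single (h k + h l) (Poly_Mapping.lookup p k * Poly_Mapping.lookup q l))"
      by (simp add: sum_product F_sum mult_single F_single h(2))
    also have "\<dots> = F p * F q"
      by (simp add: F_def sum_product mult_single)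
    finally show ?thesis .
  qed
  have F_nz: "F p \<noteq> 0" if "p \<noteq> 0" for p
  proof -
    have "Poly_Mapping.keys p \<noteq> {}" using that by simp
    then obtain k where k: "k \<in> Poly_Mapping.keys p" by blast
    have "Poly_Mapping.lookup (F p) (h k) = (\<Sum>l\<in>Poly_Mapping.keys p. if l = k then Poly_Mapping.lookup p l else 0)"
      unfolding F_def lookup_sum
      by (rule sum.cong) (use h(1) in \<open>auto simp: lookup_single when_def inj_def\<close>)
    also have "\<dots> = Poly_Mapping.lookup p k" using k by simp
    finally show ?thesis using k by (auto simp: in_keys_iff)
  qed
  have "F f * F g = 0" using F_mult[of f g] fg F_0 by simp
  then show False using F_nz assms by auto
qed

text \<open>A copy of \<open>'l \<Rightarrow>\<^sub>0 complex\<close> is needed because the \<open>idom\<close> instance of that type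
  in the library asks for a linear order on \<open>'l\<close>.\<close>

typedef 'l group_algebra = "UNIV :: ('l \<Rightarrow>\<^sub>0 complex) set"
  by simp

setup_lifting type_definition_group_algebra

instantiation group_algebra :: (free_ab_group) idom
begin

lift_definition zero_group_algebra :: "'a group_algebra" is 0 .
lift_definition one_group_algebra :: "'a group_algebra" is 1 .
lift_definition plus_group_algebra :: "'a group_algebra \<Rightarrow> 'a group_algebra \<Rightarrow> 'a group_algebra"
  is "(+)" .
lift_definition minus_group_algebra :: "'a group_algebra \<Rightarrow> 'a group_algebra \<Rightarrow> 'a group_algebra"
  is "(-)" .
lift_definition uminus_group_algebra :: "'a group_algebra \<Rightarrow> 'a group_algebra" is uminus .
lift_definition times_group_algebra :: "'a group_algebra \<Rightarrow> 'a group_algebra \<Rightarrow> 'a group_algebra"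
  is "(*)" .

instance
proof
  show "a \<noteq> 0 \<Longrightarrow> b \<noteq> 0 \<Longrightarrow> a * b \<noteq> 0" for a b :: "'a group_algebra"
    by transfer (rule group_algebra_no_zero_divisors)
qed (transfer; simp add: algebra_simps)+

end

lift_definition ga_monom :: "complex \<Rightarrow> 'l \<Rightarrow> 'l group_algebra"
  is "\<lambda>c l. Poly_Mapping.single l c" .

lift_definition ga_coeff :: "'l group_algebra \<Rightarrow> 'l \<Rightarrow> complex" is Poly_Mapping.lookup .

type_synonym 'l ratfun = "'l group_algebra fract"

definition xpow :: "'l::free_ab_group \<Rightarrow> 'l ratfun"
  where "xpow l = Fract (ga_monom 1 l) 1"

definition const :: "complex \<Rightarrow> 'l::free_ab_group ratfun"
  where "const c = Fract (ga_monom c 0) 1"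

text \<open>The \<open>\<complex>\<close>-linear endomorphism of the group algebra with \<open>x\<^sup>\<lambda> \<mapsto> \<xi>(\<lambda>) x\<^bsup>\<phi>(\<lambda>)\<^esup>\<close>.\<close>

definition ga_map :: "('l \<Rightarrow> complex) \<Rightarrow> ('l \<Rightarrow> 'l) \<Rightarrow> 'l::free_ab_group group_algebra \<Rightarrow> 'l group_algebra"
  where "ga_map \<xi> \<phi> f = (\<Sum>l | ga_coeff f l \<noteq> 0. ga_monom (\<xi> l * ga_coeff f l) (\<phi> l))"

text \<open>The extension of an injective ring endomorphism to the field of fractions.\<close>

definition fract_map :: "('a::idom \<Rightarrow> 'a) \<Rightarrow> 'a fract \<Rightarrow> 'a fract"
  where "fract_map F q = (THE y. \<exists>a b. b \<noteq> 0 \<and> q = Fract a b \<and> y = Fract (F a) (F b))"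

lemma fract_map_Fract:
  assumes "\<And>a b. F (a * b) = F a * F b" and "\<And>a. a \<noteq> 0 \<Longrightarrow> F a \<noteq> 0" and "b \<noteq> 0"
  shows "fract_map F (Fract a b) = Fract (F a) (F b)"
  unfolding fract_map_def
proof (rule the_equality)
  show "\<exists>a' b'. b' \<noteq> 0 \<and> Fract a b = Fract a' b' \<and> Fract (F a) (F b) = Fract (F a') (F b')"
    using assms(3) by blast
next
  fix y assume "\<exists>a' b'. b' \<noteq> 0 \<and> Fract a b = Fract a' b' \<and> y = Fract (F a') (F b')"
  then obtain a' b' where *: "b' \<noteq> 0" "Fract a b = Fract a' b'" "y = Fract (F a') (F b')"
    by blast
  then have "a * b' = a' * b" using assms(3) by (simp add: eq_fract)
  then have "F a * F b' = F a' * F b" by (metis assms(1))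
  then show "y = Fract (F a) (F b)" using * assms(2,3) by (simp add: eq_fract)
qed

section \<open>Root systems in a Euclidean space\<close>

definition reflection :: "'e::euclidean_space \<Rightarrow> 'e \<Rightarrow> 'e"
  where "reflection a x = x - (2 * (x \<bullet> a) / (a \<bullet> a)) *\<^sub>R a"

definition root_system :: "'e::euclidean_space set \<Rightarrow> bool"
  where "root_system \<Phi> \<longleftrightarrow> finite \<Phi> \<and> span \<Phi> = UNIV \<and> 0 \<notin> \<Phi>
    \<and> (\<forall>a\<in>\<Phi>. reflection a ` \<Phi> = \<Phi>)
    \<and> (\<forall>a\<in>\<Phi>. \<forall>b\<in>\<Phi>. 2 * (b \<bullet> a) / (a \<bullet> a) \<in> \<int>)"

definition reduced_roots :: "'e::euclidean_space set \<Rightarrow> bool"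
  where "reduced_roots \<Phi> \<longleftrightarrow> (\<forall>a\<in>\<Phi>. \<forall>c. c *\<^sub>R a \<in> \<Phi> \<longrightarrow> c = 1 \<or> c = -1)"

definition irreducible_roots :: "'e::euclidean_space set \<Rightarrow> bool"
  where "irreducible_roots \<Phi> \<longleftrightarrow> \<Phi> \<noteq> {} \<and>
    \<not> (\<exists>A B. A \<noteq> {} \<and> B \<noteq> {} \<and> A \<inter> B = {} \<and> A \<union> B = \<Phi> \<and> (\<forall>a\<in>A. \<forall>b\<in>B. a \<bullet> b = 0))"

definition simple_roots :: "'e::euclidean_space set \<Rightarrow> nat \<Rightarrow> (nat \<Rightarrow> 'e) \<Rightarrow> bool"
  where "simple_roots \<Phi> r \<alpha> \<longleftrightarrow> \<alpha> ` {1..r} \<subseteq> \<Phi> \<and> inj_on \<alpha> {1..r} \<and> independent (\<alpha> ` {1..r})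
    \<and> (\<forall>b\<in>\<Phi>. \<exists>c::nat \<Rightarrow> int. b = (\<Sum>i=1..r. of_int (c i) *\<^sub>R \<alpha> i)
          \<and> ((\<forall>i\<in>{1..r}. 0 \<le> c i) \<or> (\<forall>i\<in>{1..r}. c i \<le> 0)))"

text \<open>Reflections are involutions, so closing under products already yields a group.\<close>

inductive_set weyl_group :: "'e::euclidean_space set \<Rightarrow> ('e \<Rightarrow> 'e) set"
  for \<Phi> :: "'e set" where
  weyl_id: "id \<in> weyl_group \<Phi>"
| weyl_refl: "a \<in> \<Phi> \<Longrightarrow> w \<in> weyl_group \<Phi> \<Longrightarrow> reflection a \<circ> w \<in> weyl_group \<Phi>"

definition root_lattice :: "'e::euclidean_space set \<Rightarrow> 'e set"
  where "root_lattice \<Phi> = {\<Sum>b\<in>\<Phi>. of_int (c b) *\<^sub>R b | c::'e \<Rightarrow> int. True}"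

section \<open>Lattices containing the roots\<close>

text \<open>\<open>\<iota>\<close> identifies the roots (and their integral combinations) with elements of the lattice.\<close>

definition lattice_contains_roots :: "'e::euclidean_space set \<Rightarrow> ('e \<Rightarrow> 'l::free_ab_group) \<Rightarrow> bool"
  where "lattice_contains_roots \<Phi> \<iota> \<longleftrightarrow> inj_on \<iota> (root_lattice \<Phi>)
    \<and> (\<forall>x\<in>root_lattice \<Phi>. \<forall>y\<in>root_lattice \<Phi>. \<iota> (x + y) = \<iota> x + \<iota> y)"

definition weyl_action ::
    "'e::euclidean_space set \<Rightarrow> ('e \<Rightarrow> 'l::free_ab_group) \<Rightarrow> (('e \<Rightarrow> 'e) \<Rightarrow> 'l \<Rightarrow> 'l) \<Rightarrow> bool"
  where "weyl_action \<Phi> \<iota> act \<longleftrightarrow> act id = id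
    \<and> (\<forall>w\<in>weyl_group \<Phi>. \<forall>w'\<in>weyl_group \<Phi>. act (w \<circ> w') = act w \<circ> act w')
    \<and> (\<forall>w\<in>weyl_group \<Phi>. \<forall>l l'. act w (l + l') = act w l + act w l')
    \<and> (\<forall>w\<in>weyl_group \<Phi>. \<forall>b\<in>\<Phi>. act w (\<iota> b) = \<iota> (w b))"

definition polar :: "('l::ab_group_add \<Rightarrow> int) \<Rightarrow> 'l \<Rightarrow> 'l \<Rightarrow> int"
  where "polar Q a b = Q (a + b) - Q a - Q b"

definition quadratic_form :: "('l::ab_group_add \<Rightarrow> int) \<Rightarrow> bool"
  where "quadratic_form Q \<longleftrightarrow> (\<forall>k l. Q (k *\<^sub>Z l) = k\<^sup>2 * Q l)
    \<and> (\<forall>a b c. polar Q (a + b) c = polar Q a c + polar Q b c)"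

section \<open>The grading and the metaplectic action\<close>

definition mult_root :: "int \<Rightarrow> ('l \<Rightarrow> int) \<Rightarrow> 'l \<Rightarrow> int"
  where "mult_root n Q a = n div gcd n (Q a)"

definition sublattice0 :: "int \<Rightarrow> ('l::ab_group_add \<Rightarrow> int) \<Rightarrow> 'l set \<Rightarrow> 'l set"
  where "sublattice0 n Q S = {l. \<forall>a\<in>S. [polar Q a l = 0] (mod n)}"

text \<open>Characters of the quotient by \<open>L\<close>, pulled back to the whole lattice.\<close>

definition quotient_character :: "'l::ab_group_add set \<Rightarrow> ('l \<Rightarrow> complex) \<Rightarrow> bool"
  where "quotient_character L \<xi> \<longleftrightarrow>
    (\<forall>l. \<xi> l \<noteq> 0) \<and> (\<forall>l l'. \<xi> (l + l') = \<xi> l * \<xi> l') \<and> (\<forall>l\<in>L. \<xi> l = 1)"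

definition char_act :: "('l::free_ab_group \<Rightarrow> complex) \<Rightarrow> 'l ratfun \<Rightarrow> 'l ratfun"
  where "char_act \<xi> = fract_map (ga_map \<xi> id)"

definition perm_act :: "('l::free_ab_group \<Rightarrow> 'l) \<Rightarrow> 'l ratfun \<Rightarrow> 'l ratfun"
  where "perm_act s = fract_map (ga_map (\<lambda>_. 1) s)"

text \<open>The homogeneous component of \<open>\<K>\<close> attached to the coset of \<open>l\<close> modulo \<open>L\<close>.\<close>

definition component :: "'l::free_ab_group set \<Rightarrow> 'l \<Rightarrow> 'l ratfun set"
  where "component L l = {f. \<forall>\<xi>. quotient_character L \<xi> \<longrightarrow> char_act \<xi> f = const (\<xi> l) * f}"

text \<open>Below, \<open>a\<close> is a simple root in the lattice, \<open>s\<close> the action of its reflection on the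
  lattice, and \<open>L\<close> the sublattice defining the grading. The formula depends on \<open>l\<close> only through
  its coset modulo \<open>L\<close>.\<close>

definition metaplectic_homogeneous ::
    "int \<Rightarrow> complex \<Rightarrow> (int \<Rightarrow> complex) \<Rightarrow> ('l::free_ab_group \<Rightarrow> int) \<Rightarrow> ('l \<Rightarrow> 'l) \<Rightarrow> 'l
      \<Rightarrow> 'l \<Rightarrow> 'l ratfun \<Rightarrow> 'l ratfun"
  where "metaplectic_homogeneous n v g Q s a l f =
    (let m = mult_root n Q a in
      perm_act s f / (1 - const v * xpow (m *\<^sub>Z a)) *
      (xpow ((- ((- (polar Q l a div Q a)) mod m)) *\<^sub>Z a) * (1 - const v)
       - const v * const (g (Q a - polar Q l a)) * xpow ((1 - m) *\<^sub>Z a) * (1 - xpow (m *\<^sub>Z a))))"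

text \<open>The additive extension exists and is unique because \<open>\<K>\<close> is the direct sum of its
  components.\<close>

definition metaplectic ::
    "int \<Rightarrow> complex \<Rightarrow> (int \<Rightarrow> complex) \<Rightarrow> ('l::free_ab_group \<Rightarrow> int) \<Rightarrow> 'l set \<Rightarrow> ('l \<Rightarrow> 'l) \<Rightarrow> 'l
      \<Rightarrow> 'l ratfun \<Rightarrow> 'l ratfun"
  where "metaplectic n v g Q L s a =
    (THE S. (\<forall>f f'. S (f + f') = S f + S f')
      \<and> (\<forall>l. \<forall>f\<in>component L l. S f = metaplectic_homogeneous n v g Q s a l f))"

definition demazure ::
    "int \<Rightarrow> complex \<Rightarrow> (int \<Rightarrow> complex) \<Rightarrow> ('l::free_ab_group \<Rightarrow> int) \<Rightarrow> 'l set \<Rightarrow> ('l \<Rightarrow> 'l) \<Rightarrow> 'l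
      \<Rightarrow> 'l ratfun \<Rightarrow> 'l ratfun"
  where "demazure n v g Q L s a f =
    (let X = xpow (mult_root n Q a *\<^sub>Z a) in (f - X * metaplectic n v g Q L s a f) / (1 - X))"

definition demazure_lusztig ::
    "int \<Rightarrow> complex \<Rightarrow> (int \<Rightarrow> complex) \<Rightarrow> ('l::free_ab_group \<Rightarrow> int) \<Rightarrow> 'l set \<Rightarrow> ('l \<Rightarrow> 'l) \<Rightarrow> 'l
      \<Rightarrow> 'l ratfun \<Rightarrow> 'l ratfun"
  where "demazure_lusztig n v g Q L s a f =
    (1 - const v * xpow (mult_root n Q a *\<^sub>Z a)) * demazure n v g Q L s a f - f"

end

(* Only the rank-one situation of a single simple root a matters. Put X = x^(m a) and write S for
   the metaplectic reflection. It is semilinear over the degree-zero part: S(h f) = (s.h) S(f),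
   where s.X = 1/X. Granting S^2 = 1, semilinearity gives S(D f) = D f, hence D^2 = D; it also gives
   D((1 - v X) h) = (1 + v) h whenever S h = h, and applying this to h = D f gives the relation
   for T.

   To prove S^2 = 1, multiply numerator and denominator of a fraction by conjugates under the
   characters x^l |-> exp(2 pi i B(b, l) / n) x^l until the denominator has degree zero. By
   semilinearity it then suffices to look at monomials x^l. With t = B(l, a) / Q(a), the operator S
   maps the span of x^l and x^(l - (t - 1) a) over the degree-zero part to itself,
   and g_i g_(n-i) = 1/v is what makes its square the identity there. *)

theory Submission
  imports Defs
begin

subsection \<open>Twisted endomorphisms of the group algebra\<close>

lemma group_algebra_eqI: "(\<And>l. ga_coeff f l = ga_coeff g l) \<Longrightarrow> f = g"
  by transfer (rule poly_mapping_eqI)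

lemma ga_coeff_zero [simp]: "ga_coeff (0::'l::free_ab_group group_algebra) l = 0"
  by transfer simp

lemma ga_coeff_add [simp]:
  "ga_coeff (f + g) l = ga_coeff f l + ga_coeff (g::'l::free_ab_group group_algebra) l"
  by transfer (simp add: lookup_add)

lemma ga_coeff_monom: "ga_coeff (ga_monom c k) l = (if k = l then c else 0)"
  by transfer (simp add: lookup_single when_def)

lemma ga_coeff_sum:
  "ga_coeff (sum f A) l = (\<Sum>i\<in>A. ga_coeff (f i :: 'l::free_ab_group group_algebra) l)"
  by (induction A rule: infinite_finite_induct) auto

lemma finite_ga_support: "finite {l. ga_coeff f l \<noteq> 0}"
  by transfer simp

lemma ga_monom_zero [simp]: "ga_monom 0 l = (0::'l::free_ab_group group_algebra)"
  by (rule group_algebra_eqI) (simp add: ga_coeff_monom)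

lemma ga_monom_add:
  "ga_monom (c + d) l = ga_monom c l + (ga_monom d l :: 'l::free_ab_group group_algebra)"
  by (rule group_algebra_eqI) (simp add: ga_coeff_monom)

lemma ga_monom_mult:
  "ga_monom c k * ga_monom d l = (ga_monom (c * d) (k + l) :: 'l::free_ab_group group_algebra)"
  by transfer (simp add: mult_single)

lemma ga_monom_one: "ga_monom 1 0 = (1::'l::free_ab_group group_algebra)"
  by transfer simp

lemma ga_expand:
  fixes f :: "'l::free_ab_group group_algebra"
  shows "f = (\<Sum>l | ga_coeff f l \<noteq> 0. ga_monom (ga_coeff f l) l)"
  by (rule group_algebra_eqI) (auto simp: ga_coeff_sum ga_coeff_monom finite_ga_support)

text \<open>Monomials span additively; zero is the monomial with coefficient 0.\<close>

lemma group_algebra_induct [case_names add monom]: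
  fixes f :: "'l::free_ab_group group_algebra"
  assumes "\<And>f g. P f \<Longrightarrow> P g \<Longrightarrow> P (f + g)" and "\<And>c l. P (ga_monom c l)"
  shows "P f"
proof -
  have "P (\<Sum>l\<in>A. ga_monom (c l) l)" for A and c :: "'l \<Rightarrow> complex"
  proof (induction A rule: infinite_finite_induct)
    case (infinite A)
    then show ?case using assms(2)[of 0 0] by simp
  next
    case empty
    then show ?case using assms(2)[of 0 0] by simp
  qed (simp_all add: assms)
  then show ?thesis by (subst ga_expand)
qed

lemma ga_coeff_map:
  assumes "inj \<phi>"
  shows "ga_coeff (ga_map \<xi> \<phi> f) (\<phi> l) = \<xi> l * ga_coeff f l"
  using assms by (auto simp: ga_map_def ga_coeff_sum ga_coeff_monom inj_eq finite_ga_support)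

lemma ga_coeff_map_id: "ga_coeff (ga_map \<xi> id f) l = \<xi> l * ga_coeff f l"
  using ga_coeff_map[of id] by simp

lemma ga_map_superset:
  assumes "finite A" "{l. ga_coeff f l \<noteq> 0} \<subseteq> A"
  shows "ga_map \<xi> \<phi> f = (\<Sum>l\<in>A. ga_monom (\<xi> l * ga_coeff f l) (\<phi> l))"
  unfolding ga_map_def by (rule sum.mono_neutral_left) (use assms in auto)

lemma ga_map_monom [simp]: "ga_map \<xi> \<phi> (ga_monom c l) = ga_monom (\<xi> l * c) (\<phi> l)"
  by (subst ga_map_superset[of "{l}"]) (auto simp: ga_coeff_monom split: if_splits)

lemma ga_map_add [simp]: "ga_map \<xi> \<phi> (f + g) = ga_map \<xi> \<phi> f + ga_map \<xi> \<phi> g"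
proof -
  let ?A = "{l. ga_coeff f l \<noteq> 0} \<union> {l. ga_coeff g l \<noteq> 0}"
  have "finite ?A" by (simp add: finite_ga_support)
  then show ?thesis
    by (subst (1 2 3) ga_map_superset[of ?A])
       (auto simp: distrib_left ga_monom_add sum.distrib)
qed

lemma ga_map_comp:
  "ga_map \<xi> \<phi> (ga_map \<xi>' \<phi>' f) = ga_map (\<lambda>l. \<xi> (\<phi>' l) * \<xi>' l) (\<phi> \<circ> \<phi>') f"
  by (induction f rule: group_algebra_induct) (simp_all add: mult.assoc)

lemma ga_map_cong_support:
  "(\<And>l. ga_coeff f l \<noteq> 0 \<Longrightarrow> \<xi> l = \<xi>' l) \<Longrightarrow> ga_map \<xi> \<phi> f = ga_map \<xi>' \<phi> f"
  unfolding ga_map_def by (rule sum.cong) auto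

lemma ga_map_one_id [simp]: "ga_map (\<lambda>_. 1) id f = f"
  by (induction f rule: group_algebra_induct) simp_all

definition ring_embedding :: "('a::idom \<Rightarrow> 'a) \<Rightarrow> bool"
  where "ring_embedding F \<longleftrightarrow> F 1 = 1 \<and> (\<forall>a b. F (a + b) = F a + F b)
    \<and> (\<forall>a b. F (a * b) = F a * F b) \<and> (\<forall>a. a \<noteq> 0 \<longrightarrow> F a \<noteq> 0)"

text \<open>One notion covers both actions on the group algebra: characters have
  \<open>\<phi> = id\<close>, the reflection has trivial \<open>\<xi>\<close>.\<close>

definition twist_data :: "('l::free_ab_group \<Rightarrow> complex) \<Rightarrow> ('l \<Rightarrow> 'l) \<Rightarrow> bool"
  where "twist_data \<xi> \<phi> \<longleftrightarrow> (\<forall>l. \<xi> l \<noteq> 0) \<and> (\<forall>k l. \<xi> (k + l) = \<xi> k * \<xi> l)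
    \<and> inj \<phi> \<and> (\<forall>k l. \<phi> (k + l) = \<phi> k + \<phi> l)"

lemma twist_data_zero: "twist_data \<xi> \<phi> \<Longrightarrow> \<xi> 0 = 1" "twist_data \<xi> \<phi> \<Longrightarrow> \<phi> 0 = 0"
  unfolding twist_data_def by (metis add_0 mult_cancel_right1, metis add_0 add_cancel_left_left)

lemma ga_map_mult:
  assumes "twist_data \<xi> \<phi>"
  shows "ga_map \<xi> \<phi> (f * g) = ga_map \<xi> \<phi> f * ga_map \<xi> \<phi> g"
proof (induction f rule: group_algebra_induct)
  case (monom c k)
  show ?case
    by (induction g rule: group_algebra_induct)
       (use assms in \<open>simp_all add: distrib_left ga_monom_mult twist_data_def algebra_simps\<close>)
qed (simp add: distrib_right)

lemma ring_embedding_ga_map: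
  assumes "twist_data \<xi> \<phi>"
  shows "ring_embedding (ga_map \<xi> \<phi>)"
  unfolding ring_embedding_def
proof (intro conjI allI impI)
  show "ga_map \<xi> \<phi> 1 = 1"
    by (simp add: ga_monom_one[symmetric] twist_data_zero[OF assms])
next
  fix f :: "'a group_algebra" assume "f \<noteq> 0"
  then obtain l where "ga_coeff f l \<noteq> 0" by (metis ga_coeff_zero group_algebra_eqI)
  moreover have "inj \<phi>" "\<xi> l \<noteq> 0" using assms by (simp_all add: twist_data_def)
  ultimately have "ga_coeff (ga_map \<xi> \<phi> f) (\<phi> l) \<noteq> 0" by (simp add: ga_coeff_map)
  then show "ga_map \<xi> \<phi> f \<noteq> 0" by auto
qed (simp_all add: ga_map_mult[OF assms])

subsection \<open>Extension to the field of fractions\<close>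

context
  fixes F :: "'a::idom \<Rightarrow> 'a"
  assumes F: "ring_embedding F"
begin

lemma fract_map_Fract': "b \<noteq> 0 \<Longrightarrow> fract_map F (Fract a b) = Fract (F a) (F b)"
  using F by (intro fract_map_Fract) (auto simp: ring_embedding_def)

lemma fract_map_one: "fract_map F 1 = 1"
  using F fract_map_Fract'[of 1 1] by (simp add: ring_embedding_def One_fract_def)

lemma fract_map_add: "fract_map F (x + y) = fract_map F x + fract_map F y"
proof (cases x, cases y)
  fix a b c d assume "x = Fract a b" "b \<noteq> 0" "y = Fract c d" "d \<noteq> 0"
  then show ?thesis using F by (simp add: fract_map_Fract' ring_embedding_def)
qed

lemma fract_map_mult: "fract_map F (x * y) = fract_map F x * fract_map F y"
proof (cases x, cases y)
  fix a b c d assume "x = Fract a b" "b \<noteq> 0" "y = Fract c d" "d \<noteq> 0"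
  then show ?thesis using F by (simp add: fract_map_Fract' ring_embedding_def)
qed

lemma fract_map_zero: "fract_map F 0 = 0"
  using fract_map_add[of 0 0] by (metis add_0 add_cancel_left_left)

lemma fract_map_minus: "fract_map F (- x) = - fract_map F x"
  using fract_map_add[of x "- x"] by (simp add: fract_map_zero eq_neg_iff_add_eq_0 add.commute)

lemma fract_map_diff: "fract_map F (x - y) = fract_map F x - fract_map F y"
  using fract_map_add[of x "- y"] by (simp add: fract_map_minus)

lemma fract_map_inverse: "fract_map F (inverse x) = inverse (fract_map F x)"
proof (cases "x = 0")
  case False
  then have "fract_map F x * fract_map F (inverse x) = 1"
    by (simp add: fract_map_mult[symmetric] fract_map_one)
  then show ?thesis by (metis inverse_unique)
qed (simp add: fract_map_zero)

lemma fract_map_divide: "fract_map F (x / y) = fract_map F x / fract_map F y"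
  by (simp add: divide_inverse fract_map_mult fract_map_inverse)

lemma fract_map_sum: "fract_map F (sum f A) = (\<Sum>i\<in>A. fract_map F (f i))"
  by (induction A rule: infinite_finite_induct) (simp_all add: fract_map_zero fract_map_add)

lemmas fract_map_simps = fract_map_zero fract_map_one fract_map_add fract_map_minus
  fract_map_diff fract_map_mult fract_map_inverse fract_map_divide fract_map_sum

end

section \<open>Monomials and constants in the field of fractions\<close>

lemma xpow_add: "xpow (k + l) = xpow k * xpow l"
  by (simp add: xpow_def ga_monom_mult)

lemma xpow_zero [simp]: "xpow 0 = 1"
  by (simp add: xpow_def ga_monom_one One_fract_def)

lemma xpow_nonzero [simp]: "xpow l \<noteq> 0"
  using xpow_add[of l "- l"] by auto

lemma const_add: "const (c + d) = const c + const d"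
  by (simp add: const_def ga_monom_add)

lemma const_mult: "const (c * d) = const c * const d"
  by (simp add: const_def ga_monom_mult)

lemma const_one [simp]: "const 1 = 1"
  by (simp add: const_def ga_monom_one One_fract_def)

lemma const_zero [simp]: "const 0 = 0"
  by (simp add: const_def Zero_fract_def)

lemma const_minus: "const (- c) = - const c"
  using const_add[of c "- c"] by (simp add: eq_neg_iff_add_eq_0 add.commute)

lemma const_diff: "const (c - d) = const c - const d"
  using const_add[of c "- d"] by (simp add: const_minus)

lemma const_sum: "const (sum f A) = (\<Sum>i\<in>A. const (f i))"
  by (induction A rule: infinite_finite_induct) (simp_all add: const_add)

text \<open>The two sides differ in the coefficient at exponent 0. This keeps denominators such as
  \<open>1 - const v * xpow l\<close> nonzero.\<close>

lemma xpow_neq_const: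
  assumes "l \<noteq> 0"
  shows "const c * xpow l \<noteq> 1"
proof
  assume "const c * xpow l = 1"
  then have "ga_monom c l = 1"
    by (simp add: const_def xpow_def ga_monom_mult One_fract_def eq_fract)
  then have "ga_monom c l = ga_monom 1 0"
    by (simp add: ga_monom_one)
  from arg_cong[OF this, of "\<lambda>f. ga_coeff f 0"] show False
    using assms by (simp add: ga_coeff_monom)
qed

context
  fixes \<xi> :: "'l::free_ab_group \<Rightarrow> complex" and \<phi> :: "'l \<Rightarrow> 'l"
  assumes twist: "twist_data \<xi> \<phi>"
begin

lemma ga_map_one: "ga_map \<xi> \<phi> 1 = 1"
  using ring_embedding_ga_map[OF twist] by (simp add: ring_embedding_def)

lemma fract_map_xpow: "fract_map (ga_map \<xi> \<phi>) (xpow l) = const (\<xi> l) * xpow (\<phi> l)"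
  by (simp add: xpow_def const_def fract_map_Fract' ring_embedding_ga_map twist ga_monom_mult
      ga_map_one)

lemma fract_map_const: "fract_map (ga_map \<xi> \<phi>) (const c) = const c"
  using twist_data_zero[OF twist]
  by (simp add: const_def fract_map_Fract' ring_embedding_ga_map twist ga_map_one)

lemmas twist_simps = fract_map_simps[OF ring_embedding_ga_map[OF twist]]
  fract_map_xpow fract_map_const

end

subsection \<open>Homogeneous decomposition\<close>

definition zeta :: "int \<Rightarrow> int \<Rightarrow> complex"
  where "zeta n k = cis (2 * pi * of_int k / of_int n)"

lemma zeta_add: "zeta n (j + k) = zeta n j * zeta n k"
  by (simp add: zeta_def cis_mult add_divide_distrib distrib_left)

lemma zeta_zero [simp]: "zeta n 0 = 1"
  by (simp add: zeta_def)

lemma zeta_nonzero [simp]: "zeta n k \<noteq> 0"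
  by (simp add: zeta_def)

lemma zeta_power: "zeta n k ^ j = zeta n (int j * k)"
  by (induction j) (simp_all add: distrib_right zeta_add)

lemma zeta_eq_1_iff:
  assumes "1 \<le> n"
  shows "zeta n k = 1 \<longleftrightarrow> n dvd k"
proof
  assume "zeta n k = 1"
  then have "cos (2 * pi * of_int k / of_int n) = 1"
    by (simp add: zeta_def complex_eq_iff)
  then obtain j :: int where "2 * pi * of_int k / of_int n = of_int j * 2 * pi"
    by (auto simp: cos_one_2pi_int)
  then have "real_of_int k = of_int (j * n)"
    using assms by (simp add: field_simps)
  then have "k = j * n" by (simp only: of_int_eq_iff)
  then show "n dvd k" by simp
next
  assume "n dvd k"
  then obtain j where "k = n * j" ..
  then have "2 * pi * of_int k / of_int n = 2 * pi * real_of_int j"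
    using assms by simp
  then show "zeta n k = 1" by (simp add: zeta_def cis_multiple_2pi)
qed

text \<open>Orthogonality of the characters of Z/n: off the multiples of \<open>n\<close> this is a
  geometric sum whose ratio is a nontrivial n-th root of unity.\<close>

lemma zeta_sum:
  assumes "1 \<le> n"
  shows "(\<Sum>k<nat n. zeta n (int k * j)) = (if n dvd j then of_int n else 0)"
proof (cases "n dvd j")
  case True
  then have "zeta n (int k * j) = 1" for k
    using zeta_eq_1_iff[OF assms] by simp
  then show ?thesis using True assms by simp
next
  case False
  have "(\<Sum>k<nat n. zeta n j ^ k) = (zeta n j ^ nat n - 1) / (zeta n j - 1)"
    using False zeta_eq_1_iff[OF assms] by (intro geometric_sum) simp
  moreover have "zeta n j ^ nat n = 1"
    using assms zeta_eq_1_iff[OF assms] by (simp add: zeta_power)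
  ultimately show ?thesis using False by (simp add: zeta_power)
qed

lemma ring_embedding_prod:
  "ring_embedding F \<Longrightarrow> F (prod f A) = (\<Prod>i\<in>A. F (f i))"
  by (induction A rule: infinite_finite_induct) (simp_all add: ring_embedding_def)

text \<open>The component of the trivial coset; it plays the role of the scalar field.\<close>

definition grade_zero :: "'l::free_ab_group set \<Rightarrow> 'l ratfun \<Rightarrow> bool"
  where "grade_zero L h \<longleftrightarrow> (\<forall>\<xi>. quotient_character L \<xi> \<longrightarrow> char_act \<xi> h = h)"

lemma twist_data_quotient_character: "quotient_character L \<xi> \<Longrightarrow> twist_data \<xi> id"
  by (simp add: quotient_character_def twist_data_def)

lemma grade_zero_component:
  assumes "grade_zero L h"
  shows "xpow l * h \<in> component L l"
  unfolding component_def
proof safe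
  fix \<xi> assume \<xi>: "quotient_character L \<xi>"
  then have "char_act \<xi> h = h" using assms by (simp add: grade_zero_def)
  then show "char_act \<xi> (xpow l * h) = const (\<xi> l) * (xpow l * h)"
    using twist_data_quotient_character[OF \<xi>] by (simp add: char_act_def twist_simps)
qed

section \<open>The polar form of \<open>Q\<close> and degree-zero denominators\<close>

lemma polar_commute: "polar Q x y = polar Q y x"
  by (simp add: polar_def add.commute)

context
  fixes Q :: "'l::free_ab_group \<Rightarrow> int"
  assumes Q: "quadratic_form Q"
begin

lemma polar_add_left: "polar Q (x + y) z = polar Q x z + polar Q y z"
  using Q by (simp add: quadratic_form_def)

lemma polar_add_right: "polar Q z (x + y) = polar Q z x + polar Q z y"
  using polar_add_left polar_commute by metis

lemma polar_zero_left [simp]: "polar Q 0 z = 0"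
  using polar_add_left[of 0 0 z] by simp

lemma polar_diff_left: "polar Q (x - y) z = polar Q x z - polar Q y z"
  using polar_add_left[of "x - y" y z] by simp

lemma polar_zscale_left: "polar Q (k *\<^sub>Z x) z = k * polar Q x z"
proof (induction k rule: int_induct[where k = 0])
  case (step1 i)
  then show ?case by (simp add: zscale_succ polar_add_left distrib_right)
next
  case (step2 i)
  then show ?case
    using zscale_succ[of "i - 1" x] polar_add_left[of "(i - 1) *\<^sub>Z x" x z]
    by (simp add: algebra_simps)
qed simp

lemma polar_self: "polar Q x x = 2 * Q x"
proof -
  have "2 *\<^sub>Z x = x + x" using zscale_succ[of 1 x] zscale_succ[of 0 x] by simp
  moreover have "Q (2 *\<^sub>Z x) = 4 * Q x" using Q by (simp add: quadratic_form_def)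
  ultimately show ?thesis by (simp add: polar_def)
qed

lemma twist_data_zeta: "twist_data (\<lambda>l. zeta n (k * polar Q b l)) id"
  by (simp add: twist_data_def polar_add_right distrib_left zeta_add)

text \<open>The multiple is the norm: the product of all conjugates under the given characters.\<close>

lemma ex_invariant_multiple:
  assumes "finite J" "1 \<le> n" "d \<noteq> 0"
  shows "\<exists>e. e \<noteq> 0 \<and> (\<forall>b\<in>J. ga_map (\<lambda>l. zeta n (polar Q b l)) id (d * e) = d * e)"
  using assms(1)
proof (induction J rule: finite_induct)
  case empty
  show ?case by (rule exI[of _ 1]) simp
next
  case (insert b J)
  then obtain e where e: "e \<noteq> 0"
    "\<And>b. b \<in> J \<Longrightarrow> ga_map (\<lambda>l. zeta n (polar Q b l)) id (d * e) = d * e"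
    by blast
  define x where "x = d * e"
  have x: "x \<noteq> 0" using e assms by (simp add: x_def)
  define F where "F k = ga_map (\<lambda>l. zeta n (int k * polar Q b l)) id" for k
  have F: "ring_embedding (F k)" for k
    unfolding F_def by (intro ring_embedding_ga_map twist_data_zeta)
  have F0: "F 0 x = x" by (simp add: F_def)
  \<comment> \<open>The n-th power of the character is trivial, so the conjugates of
    \<open>x\<close> recur with period \<open>n\<close>.\<close>
  have "zeta n (n * k) = 1" for k
    using assms zeta_eq_1_iff by simp
  then have FN: "F (nat n) x = x" using assms by (simp add: F_def)
  define y where "y = (\<Prod>k<nat n. F k x)"
  have "{..<nat n} = insert 0 {1..<nat n}" using assms by auto
  then have "y = x * (\<Prod>k\<in>{1..<nat n}. F k x)" by (simp add: y_def F0)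
  then have y: "y = d * (e * (\<Prod>k\<in>{1..<nat n}. F k x))" by (simp add: x_def mult.assoc)
  have "e * (\<Prod>k\<in>{1..<nat n}. F k x) \<noteq> 0"
    using e x F by (simp add: ring_embedding_def)
  moreover have "ga_map (\<lambda>l. zeta n (polar Q b' l)) id y = y" if "b' \<in> insert b J" for b'
  proof -
    define G where "G = ga_map (\<lambda>l. zeta n (polar Q b' l)) id"
    have "ring_embedding G"
      unfolding G_def using ring_embedding_ga_map[OF twist_data_zeta[of n 1 b']] by simp
    then have Gy: "G y = (\<Prod>k<nat n. G (F k x))"
      unfolding y_def by (rule ring_embedding_prod)
    have "G y = y"
    proof (cases "b' = b")
      case True
      \<comment> \<open>The character advances each conjugate by one. Multiplying by
        \<open>x\<close> restores the missing first factor, and the new last factor is again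
        \<open>x\<close>.\<close>
      have "G (F k x) = F (Suc k) x" for k
        unfolding G_def F_def True by (simp add: ga_map_comp distrib_right zeta_add)
      then have "x * G y = (\<Prod>k<Suc (nat n). F k x)"
        unfolding Gy by (simp add: prod.lessThan_Suc_shift F0 del: prod.lessThan_Suc)
      also have "\<dots> = x * y" by (simp add: FN y_def mult.commute)
      finally show ?thesis using x by simp
    next
      case False
      \<comment> \<open>Here \<open>x\<close> is already invariant, and characters commute, so every
        conjugate of \<open>x\<close> is invariant too.\<close>
      then have "G x = x" using e(2) that by (simp add: G_def x_def)
      moreover have "G (F k x) = F k (G x)" for k
        unfolding G_def F_def by (simp add: ga_map_comp mult.commute)
      ultimately show ?thesis unfolding Gy by (simp add: y_def)
    qed
    then show ?thesis by (simp add: G_def)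
  qed
  ultimately show ?case using y by metis
qed

text \<open>This serves as the decomposition of the fraction field into components: over a
  degree-zero denominator the numerator splits into monomials, and each term is a monomial times an
  element of degree zero.\<close>

lemma ratfun_homogeneous_induct [consumes 2, case_names add homogeneous]:
  fixes f :: "'l ratfun"
  assumes "finite J" "1 \<le> n"
    and add: "\<And>f g. P f \<Longrightarrow> P g \<Longrightarrow> P (f + g)"
    and hom: "\<And>l h. grade_zero (sublattice0 n Q J) h \<Longrightarrow> P (xpow l * h)"
  shows "P f"
proof (cases f)
  case (Fract p d)
  then have "d \<noteq> 0" by simp
  from ex_invariant_multiple[OF assms(1,2) this] obtain e
    where e: "e \<noteq> 0" "\<And>b. b \<in> J \<Longrightarrow> ga_map (\<lambda>l. zeta n (polar Q b l)) id (d * e) = d * e"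
    by blast
  define N where "N = d * e"
  have N: "N \<noteq> 0" using e \<open>d \<noteq> 0\<close> by (simp add: N_def)
  \<comment> \<open>Invariance under the finitely many characters of \<open>J\<close> confines the
    support of \<open>N\<close> to the sublattice, and thereby makes \<open>N\<close> invariant
    under all quotient characters.\<close>
  have supp: "l \<in> sublattice0 n Q J" if "ga_coeff N l \<noteq> 0" for l
    unfolding sublattice0_def
  proof safe
    fix b assume "b \<in> J"
    then have "ga_map (\<lambda>l. zeta n (polar Q b l)) id N = N" using e(2) by (simp add: N_def)
    then have "zeta n (polar Q b l) * ga_coeff N l = ga_coeff N l"
      using ga_coeff_map_id[of "\<lambda>l. zeta n (polar Q b l)" N l] by simp
    then have "zeta n (polar Q b l) = 1" using that by simp
    then show "[polar Q b l = 0] (mod n)"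
      using zeta_eq_1_iff[OF assms(2)] by (simp add: cong_0_iff)
  qed
  have "P (Fract q N)" for q
  proof (induction q rule: group_algebra_induct)
    case (add f g)
    have "Fract (f + g) N = Fract f N + Fract g N"
      using N by (simp add: eq_fract distrib_left distrib_right mult.assoc)
    then show ?case using add assms(3) by simp
  next
    case (monom c l)
    have "grade_zero (sublattice0 n Q J) (Fract (ga_monom c 0) N)"
      unfolding grade_zero_def
    proof safe
      fix \<xi> assume \<xi>: "quotient_character (sublattice0 n Q J) \<xi>"
      have t: "twist_data \<xi> id" by (rule twist_data_quotient_character) fact
      have "ga_map \<xi> id N = ga_map (\<lambda>_. 1) id N"
        using \<xi> supp by (intro ga_map_cong_support) (auto simp: quotient_character_def)
      then have "ga_map \<xi> id N = N" by simp
      then show "char_act \<xi> (Fract (ga_monom c 0) N) = Fract (ga_monom c 0) N"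
        unfolding char_act_def using N twist_data_zero[OF t]
        by (simp add: fract_map_Fract' ring_embedding_ga_map[OF t])
    qed
    from hom[OF this, of l] show ?case
      by (simp add: xpow_def ga_monom_mult)
  qed
  moreover have "f = Fract (p * e) N"
    using Fract e N by (simp add: N_def eq_fract mult_ac)
  ultimately show ?thesis by simp
qed

end

subsection \<open>The metaplectic reflection\<close>

text \<open>\<open>J\<close> stands for the set of all simple roots, which fixes the grading;
  \<open>a\<close> is the one reflected in.\<close>

locale metaplectic_reflection =
  fixes n :: int and v :: complex and g :: "int \<Rightarrow> complex" and Q :: "'l::free_ab_group \<Rightarrow> int"
    and J L :: "'l set" and a :: 'l and s :: "'l \<Rightarrow> 'l"
  assumes Q: "quadratic_form Q" and n: "1 \<le> n" and J: "finite J" "a \<in> J"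
    and L_def: "L = sublattice0 n Q J"
    and Qa: "Q a \<noteq> 0" and dvd: "\<And>l. Q a dvd polar Q l a"
    and s: "\<And>l. s l = l - (polar Q l a div Q a) *\<^sub>Z a"
    and v: "v \<noteq> 0" and g_mod: "\<And>j. g (j mod n) = g j" and g0: "g 0 = -1"
    and g_pair: "\<And>j. 1 \<le> j \<Longrightarrow> j < n \<Longrightarrow> g j * g (n - j) = inverse v"
begin

text \<open>The pairing of \<open>l\<close> with the coroot of \<open>a\<close>.\<close>

definition coord :: "'l \<Rightarrow> int"
  where "coord l = polar Q l a div Q a"

definition m :: int
  where "m = mult_root n Q a"

definition u :: "int \<Rightarrow> 'l ratfun"
  where "u k = xpow (k *\<^sub>Z a)"

text \<open>The bracket of the metaplectic action over its denominator, as a function of the pairing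
  \<open>t\<close> with the coroot.\<close>

definition factor :: "int \<Rightarrow> 'l ratfun"
  where "factor t = (u (- ((- t) mod m)) * (1 - const v)
    - const v * const (g (Q a * (1 - t))) * u (1 - m) * (1 - u m)) / (1 - const v * u m)"

lemma polar_coord: "polar Q l a = Q a * coord l"
  using dvd by (simp add: coord_def)

lemma metaplectic_homogeneous_eq:
  "metaplectic_homogeneous n v g Q s a l f = perm_act s f * factor (coord l)"
proof -
  have "Q a - polar Q l a = Q a * (1 - coord l)" by (simp add: polar_coord algebra_simps)
  then show ?thesis
    by (simp add: metaplectic_homogeneous_def factor_def Let_def u_def flip: m_def coord_def)
qed

lemma m_pos: "m > 0"
proof -
  have "gcd n (Q a) > 0" using Qa by simp
  moreover have "gcd n (Q a) \<le> n" using n by (simp add: gcd_le1_int)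
  ultimately show ?thesis by (simp add: m_def mult_root_def pos_imp_zdiv_pos_iff)
qed

text \<open>\<open>m\<close> is the additive order of \<open>Q a\<close> modulo \<open>n\<close>:
  after cancelling the gcd, the cofactor of \<open>Q a\<close> is coprime to
  \<open>m\<close>.\<close>

lemma dvd_root_mult_iff: "n dvd Q a * k \<longleftrightarrow> m dvd k"
proof -
  define d where "d = gcd n (Q a)"
  have d: "d \<noteq> 0" using Qa by (simp add: d_def)
  obtain q where q: "Q a = d * q" unfolding d_def by (meson dvdE gcd_dvd2)
  have nm: "n = d * m" by (simp add: d_def m_def mult_root_def)
  have "coprime (n div d) (Q a div d)"
    unfolding d_def using Qa by (intro div_gcd_coprime) simp
  moreover have "n div d = m" by (simp add: d_def m_def mult_root_def)
  ultimately have "coprime m q" using d q by simp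
  then show ?thesis
    unfolding q by (subst nm) (use d in \<open>simp add: mult.assoc coprime_dvd_mult_right_iff\<close>)
qed

lemma g_cong: "n dvd j - k \<Longrightarrow> g j = g k"
  by (metis g_mod mod_eq_dvd_iff)

lemma g_opposite:
  assumes "\<not> n dvd j"
  shows "v * g j * g (- j) = 1"
proof -
  have "j mod n \<noteq> 0" using assms by (simp add: dvd_eq_mod_eq_0)
  then have "1 \<le> j mod n" "j mod n < n"
    using n pos_mod_sign[of n j] pos_mod_bound[of n j] by linarith+
  then have "g (j mod n) * g (n - j mod n) = inverse v" by (rule g_pair)
  moreover have "g (n - j mod n) = g (- j)"
  proof (rule g_cong)
    have "n dvd n + (j - j mod n)" by (intro dvd_add dvd_refl dvd_minus_mod)
    then show "n dvd n - j mod n - - j" by (simp add: algebra_simps)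
  qed
  ultimately show ?thesis using v by (simp add: g_mod field_simps)
qed

text \<open>Shifting \<open>t\<close> by a multiple of \<open>m\<close> changes neither the
  remainder nor, by \<open>dvd_root_mult_iff\<close>, the class mod \<open>n\<close> of the index of
  \<open>g\<close>.\<close>

lemma factor_cong:
  assumes "m dvd t - t'"
  shows "factor t = factor t'"
proof -
  have "(- t) mod m = (- t') mod m"
    using assms by (intro mod_minus_cong) (simp add: mod_eq_dvd_iff)
  moreover have "n dvd Q a * (1 - t) - Q a * (1 - t')"
  proof -
    have "Q a * (1 - t) - Q a * (1 - t') = Q a * (- (t - t'))" by (simp add: algebra_simps)
    then show ?thesis using assms dvd_root_mult_iff by (metis dvd_minus_iff)
  qed
  then have "g (Q a * (1 - t)) = g (Q a * (1 - t'))" by (rule g_cong)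
  ultimately show ?thesis by (simp add: factor_def)
qed

section \<open>The reflection on exponents and on powers of x^a\<close>

lemma coord_add: "coord (k + l) = coord k + coord l"
  using dvd by (simp add: coord_def polar_add_left[OF Q] div_add)

lemma coord_root: "coord (k *\<^sub>Z a) = 2 * k"
  using Qa by (simp add: coord_def polar_zscale_left[OF Q] polar_self[OF Q])

lemma zscale_minus: "(- k) *\<^sub>Z a = - (k *\<^sub>Z a)"
  using zscale_add_left[of k "- k" a] by (simp add: eq_neg_iff_add_eq_0 add.commute)

lemma zscale_diff: "(j - k) *\<^sub>Z a = j *\<^sub>Z a - k *\<^sub>Z a"
  using zscale_add_left[of j "- k" a] by (simp add: zscale_minus)

lemma s_eq: "s l = l - coord l *\<^sub>Z a"
  by (simp add: s coord_def)

lemma coord_diff: "coord (k - l) = coord k - coord l"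
  using coord_add[of "k - l" l] by simp

lemma s_add: "s (k + l) = s k + s l"
  by (simp add: s_eq coord_add zscale_add_left)

lemma s_involution: "s (s l) = l"
  by (simp add: s_eq[of "s l"]) (simp add: s_eq coord_diff coord_root zscale_minus zscale_diff)

lemma s_root: "s (k *\<^sub>Z a) = (- k) *\<^sub>Z a"
  using zscale_add_left[of k k a] by (simp add: s_eq coord_root zscale_minus)

lemma twist_data_s: "twist_data (\<lambda>_. 1) s"
  by (simp add: twist_data_def s_add) (metis injI s_involution)

lemmas perm_simps = twist_simps[OF twist_data_s, folded perm_act_def]

lemma perm_u: "perm_act s (u k) = u (- k)"
  by (simp add: u_def perm_simps s_root)

lemma perm_involution: "perm_act s (perm_act s f) = f"
proof (cases f)
  case (Fract p d)
  have "s \<circ> s = id" by (auto simp: s_involution)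
  moreover have "ga_map (\<lambda>_. 1) s d \<noteq> 0"
    using Fract ring_embedding_ga_map[OF twist_data_s] by (simp add: ring_embedding_def)
  ultimately show ?thesis
    using Fract
    by (simp add: perm_act_def fract_map_Fract'[OF ring_embedding_ga_map[OF twist_data_s]] ga_map_comp)
qed

lemma u_add: "u (j + k) = u j * u k"
  by (simp add: u_def zscale_add_left xpow_add)

lemma xpow_minus_root: "xpow (l - k *\<^sub>Z a) = xpow l * u (- k)"
  by (simp add: u_def zscale_minus flip: xpow_add)

lemma u_zero [simp]: "u 0 = 1"
  by (simp add: u_def)

lemma u_nonzero [simp]: "u k \<noteq> 0"
  by (simp add: u_def)

lemma u_minus: "u (- k) = 1 / u k"
  using u_add[of k "- k"] by (simp add: field_simps)

lemma const_u_neq_1: "const c * u m \<noteq> 1"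
proof -
  have "Q (k *\<^sub>Z a) = k\<^sup>2 * Q a" for k
    using Q unfolding quadratic_form_def by blast
  \<comment> \<open>\<open>Q\<close> separates the two multiples: it is 0 at 0 and
    \<open>m\<^sup>2 * Q a\<close> at \<open>m *\<^sub>Z a\<close>.\<close>
  from this[of 0] this[of m] have "m *\<^sub>Z a \<noteq> 0"
    using Qa m_pos by auto
  then show ?thesis unfolding u_def by (rule xpow_neq_const)
qed

lemma u_neq_1: "u m \<noteq> 1"
  using const_u_neq_1[of 1] by simp

subsection \<open>Existence and uniqueness of the additive extension\<close>

definition is_extension :: "('l ratfun \<Rightarrow> 'l ratfun) \<Rightarrow> bool"
  where "is_extension S \<longleftrightarrow> (\<forall>f f'. S (f + f') = S f + S f')
    \<and> (\<forall>l. \<forall>f\<in>component L l. S f = metaplectic_homogeneous n v g Q s a l f)"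

lemma homogeneous_induct [case_names add homogeneous]:
  assumes add: "\<And>f g. P f \<Longrightarrow> P g \<Longrightarrow> P (f + g)"
    and hom: "\<And>l h. grade_zero L h \<Longrightarrow> P (xpow l * h)"
  shows "P f"
  by (rule ratfun_homogeneous_induct[OF Q J(1) n, where P = P and f = f, folded L_def])
    (erule (1) add, erule hom)

text \<open>Products of monomials with degree-zero elements span additively, and each lies in a
  component, where the value is prescribed.\<close>

lemma extension_unique:
  assumes "is_extension S" "is_extension S'"
  shows "S = S'"
proof
  fix f show "S f = S' f"
  proof (induction f rule: homogeneous_induct)
    case (add f g)
    then show ?case using assms by (simp add: is_extension_def)
  next
    case (homogeneous l h)
    then show ?case
      using assms grade_zero_component[of L h l] by (simp add: is_extension_def)
  qed
qed

definition char_a :: "nat \<Rightarrow> 'l \<Rightarrow> complex"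
  where "char_a k l = zeta n (int k * polar Q a l)"

lemma twist_data_char_a: "twist_data (char_a k) id"
  unfolding char_a_def by (rule twist_data_zeta[OF Q])

lemma quotient_character_char_a: "quotient_character L (char_a k)"
  using twist_data_char_a[of k] J zeta_eq_1_iff[OF n]
  by (auto simp: quotient_character_def twist_data_def L_def sublattice0_def char_a_def cong_0_iff)

text \<open>The projection onto all components with \<open>polar Q a l\<close> congruent to
  \<open>b\<close> mod \<open>n\<close>, obtained by averaging over the powers of one character.
  This grading is coarser than the full one but still determines \<open>factor\<close>.\<close>

definition proj :: "int \<Rightarrow> 'l ratfun \<Rightarrow> 'l ratfun"
  where "proj b f = const (1 / of_int n) *
    (\<Sum>k<nat n. const (zeta n (int k * (- b))) * char_act (char_a k) f)"

lemma proj_add: "proj b (f + f') = proj b f + proj b f'"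
  by (simp add: proj_def char_act_def twist_simps[OF twist_data_char_a] distrib_left sum.distrib)

lemma proj_component:
  assumes "f \<in> component L l"
  shows "proj b f = (if n dvd polar Q a l - b then f else 0)"
proof -
  have "char_act (char_a k) f = const (char_a k l) * f" for k
    using assms quotient_character_char_a by (simp add: component_def)
  then have "proj b f = const (1 / of_int n) *
      (\<Sum>k<nat n. const (zeta n (int k * (- b)) * char_a k l) * f)"
    by (simp add: proj_def const_mult mult.assoc)
  also have "\<dots> = const (1 / of_int n * (\<Sum>k<nat n. zeta n (int k * (- b)) * char_a k l)) * f"
    by (simp only: const_mult const_sum sum_distrib_right mult.assoc)
  also have "(\<Sum>k<nat n. zeta n (int k * (- b)) * char_a k l)
      = (\<Sum>k<nat n. zeta n (int k * (polar Q a l - b)))"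
    by (simp add: char_a_def zeta_add[symmetric] algebra_simps)
  also have "\<dots> = (if n dvd polar Q a l - b then of_int n else 0)"
    by (rule zeta_sum[OF n])
  finally show ?thesis using n by simp
qed

text \<open>Dividing a representative of \<open>B(\<lambda>, \<alpha>)\<close> modulo \<open>n\<close> by \<open>Q(\<alpha>)\<close> need not recover
  \<open>B(\<lambda>, \<alpha>) / Q(\<alpha>)\<close> modulo \<open>m(\<alpha>)\<close>; hence the choice of a multiple of \<open>Q(\<alpha>)\<close> in each class.\<close>

lemma ex_extension: "\<exists>S. is_extension S"
proof
  define \<tau> where "\<tau> b = (SOME t. n dvd Q a * t - b)" for b
  \<comment> \<open>Additive by construction; on a component only the summand of its own residue
    survives.\<close>
  define S where "S f = (\<Sum>b\<in>{0..<n}. perm_act s (proj b f) * factor (\<tau> b))" for f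
  show "is_extension S"
    unfolding is_extension_def
  proof safe
    fix f f' show "S (f + f') = S f + S f'"
      by (simp add: S_def proj_add perm_simps distrib_right sum.distrib)
  next
    fix l f assume f: "f \<in> component L l"
    define c where "c = polar Q a l mod n"
    have c: "c \<in> {0..<n}" using n by (simp add: c_def)
    have pl: "polar Q a l = Q a * coord l"
      by (metis polar_coord polar_commute)
    have b: "n dvd polar Q a l - b \<longleftrightarrow> b = c" if "b \<in> {0..<n}" for b
      using that unfolding mod_eq_dvd_iff[symmetric] c_def by auto
    \<comment> \<open>\<open>coord l\<close> shows that the choice defining \<open>\<tau> c\<close>
      has a solution.\<close>
    have "n dvd Q a * coord l - c" using b[OF c] by (simp add: pl)
    then have "n dvd Q a * \<tau> c - c" unfolding \<tau>_def by (rule someI)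
    with \<open>n dvd Q a * coord l - c\<close> have "n dvd Q a * (\<tau> c - coord l)"
      using dvd_diff[of n "Q a * \<tau> c - c" "Q a * coord l - c"] by (simp add: algebra_simps)
    then have \<tau>: "factor (\<tau> c) = factor (coord l)"
      by (intro factor_cong) (simp add: dvd_root_mult_iff)
    have "S f = (\<Sum>b\<in>{0..<n}. if b = c then perm_act s f * factor (\<tau> b) else 0)"
      unfolding S_def
      by (rule sum.cong) (auto simp: proj_component[OF f] b perm_simps)
    also have "\<dots> = perm_act s f * factor (coord l)"
      using c by (simp add: \<tau>)
    finally show "S f = metaplectic_homogeneous n v g Q s a l f"
      by (simp add: metaplectic_homogeneous_eq)
  qed
qed

definition S :: "'l ratfun \<Rightarrow> 'l ratfun"
  where "S = metaplectic n v g Q L s a"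

text \<open>Existence and uniqueness make the definite description in \<open>metaplectic\<close>
  denote the extension.\<close>

lemma is_extension_S: "is_extension S"
proof -
  from ex_extension obtain S' where "is_extension S'" by blast
  with extension_unique have "\<exists>!S. is_extension S" by blast
  then have "is_extension (The is_extension)" by (rule theI')
  then show ?thesis by (simp add: S_def metaplectic_def is_extension_def[abs_def])
qed

lemma S_add: "S (f + f') = S f + S f'"
  using is_extension_S by (simp add: is_extension_def)

lemma S_homogeneous:
  "grade_zero L h \<Longrightarrow> S (xpow l * h) = perm_act s (xpow l * h) * factor (coord l)"
  using is_extension_S grade_zero_component
  by (metis is_extension_def metaplectic_homogeneous_eq)

section \<open>The degree-zero field and semilinearity of \<open>S\<close>\<close>

lemma grade_zero_mult: "grade_zero L h \<Longrightarrow> grade_zero L h' \<Longrightarrow> grade_zero L (h * h')"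
  using twist_data_quotient_character[of L]
  by (simp add: grade_zero_def char_act_def twist_simps)

lemma grade_zero_divide: "grade_zero L h \<Longrightarrow> grade_zero L h' \<Longrightarrow> grade_zero L (h / h')"
  using twist_data_quotient_character[of L]
  by (simp add: grade_zero_def char_act_def twist_simps)

lemma grade_zero_diff: "grade_zero L h \<Longrightarrow> grade_zero L h' \<Longrightarrow> grade_zero L (h - h')"
  using twist_data_quotient_character[of L]
  by (simp add: grade_zero_def char_act_def twist_simps)

lemma grade_zero_const: "grade_zero L (const c)"
  using twist_data_quotient_character[of L]
  by (simp add: grade_zero_def char_act_def twist_simps)

lemma grade_zero_one: "grade_zero L 1"
  using grade_zero_const[of 1] by simp

text \<open>The vector \<open>m *\<^sub>Z a\<close> lies in \<open>L\<close>: its pairing with any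
  \<open>b\<close> is \<open>Q a * m * coord b\<close>, and \<open>n\<close> divides
  \<open>Q a * m\<close>.\<close>

lemma grade_zero_u: "grade_zero L (u (m * k))"
proof -
  have "(m * k) *\<^sub>Z a \<in> L"
    unfolding L_def sublattice0_def
  proof safe
    fix b assume "b \<in> J"
    have "polar Q b ((m * k) *\<^sub>Z a) = Q a * (m * k * coord b)"
      by (subst polar_commute)
        (simp add: polar_zscale_left[OF Q] polar_commute[of Q a] polar_coord)
    moreover have "n dvd Q a * (m * k * coord b)" by (simp add: dvd_root_mult_iff)
    ultimately show "[polar Q b ((m * k) *\<^sub>Z a) = 0] (mod n)" by (simp add: cong_0_iff)
  qed
  then show ?thesis
    using twist_data_quotient_character[of L]
    by (simp add: grade_zero_def char_act_def twist_simps u_def quotient_character_def)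
qed

lemma grade_zero_u_m: "grade_zero L (u m)"
  using grade_zero_u[of 1] by simp

lemmas grade_zero_intros = grade_zero_mult grade_zero_divide grade_zero_diff grade_zero_const
  grade_zero_one grade_zero_u_m

lemma grade_zero_one_minus: "grade_zero L (1 - const c * u m)"
  by (rule grade_zero_diff[OF grade_zero_one grade_zero_mult[OF grade_zero_const grade_zero_u_m]])

text \<open>By symmetry of the form, \<open>coord l * polar Q a b = polar Q a l * coord b\<close>,
  and \<open>n\<close> divides \<open>polar Q a l\<close> because \<open>a\<close> belongs to
  \<open>J\<close>.\<close>

lemma s_sublattice:
  assumes "l \<in> L"
  shows "s l \<in> L"
  unfolding L_def sublattice0_def
proof safe
  fix b assume b: "b \<in> J"
  have "polar Q b (s l) = polar Q (s l) b" by (rule polar_commute)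
  also have "\<dots> = polar Q b l - coord l * polar Q a b"
    by (simp add: s_eq polar_diff_left[OF Q] polar_zscale_left[OF Q] polar_commute[of Q l])
  also have "coord l * polar Q a b = polar Q a l * coord b"
    using polar_coord[of l] polar_coord[of b] by (simp add: polar_commute[of Q a])
  finally show "[polar Q b (s l) = 0] (mod n)"
    using assms b J by (simp add: L_def sublattice0_def cong_0_iff)
qed

text \<open>Moving a character past the reflection replaces \<open>\<xi>\<close> by
  \<open>\<xi> \<circ> s\<close>, which is again trivial on \<open>L\<close>.\<close>

lemma grade_zero_perm:
  assumes "grade_zero L h"
  shows "grade_zero L (perm_act s h)"
  unfolding grade_zero_def
proof safe
  fix \<xi> assume \<xi>: "quotient_character L \<xi>"
  then have \<xi>s: "quotient_character L (\<xi> \<circ> s)"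
    by (auto simp: quotient_character_def s_add s_sublattice)
  note t = twist_data_quotient_character[OF \<xi>] twist_data_quotient_character[OF \<xi>s] twist_data_s
  note e = t[THEN ring_embedding_ga_map]
  have "char_act \<xi> (perm_act s h) = perm_act s (char_act (\<xi> \<circ> s) h)"
  proof (cases h)
    case (Fract p d)
    with e have "ga_map (\<lambda>_. 1) s d \<noteq> 0" "ga_map (\<xi> \<circ> s) id d \<noteq> 0"
      by (simp_all add: ring_embedding_def)
    with Fract show ?thesis
      by (simp add: char_act_def perm_act_def e[THEN fract_map_Fract', unfolded o_def]
          ga_map_comp o_def)
  qed
  also have "char_act (\<xi> \<circ> s) h = h" using assms \<xi>s by (simp add: grade_zero_def)
  finally show "char_act \<xi> (perm_act s h) = perm_act s h" .
qed

text \<open>A degree-zero factor leaves the component unchanged, so \<open>factor\<close> is the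
  same and only the multiplicative permutation action sees \<open>h\<close>.\<close>

lemma S_mult:
  assumes "grade_zero L h"
  shows "S (h * f) = perm_act s h * S f"
proof (induction f rule: homogeneous_induct)
  case (add f g)
  then show ?case by (simp add: S_add distrib_left)
next
  case (homogeneous l h')
  have "h * (xpow l * h') = xpow l * (h * h')" by (simp add: mult_ac)
  then show ?case
    using S_homogeneous[OF homogeneous] S_homogeneous[OF grade_zero_mult[OF assms homogeneous]]
    by (simp add: perm_simps mult_ac)
qed

subsection \<open>The metaplectic reflection is an involution\<close>

text \<open>The exponent \<open>coord l + (- coord l) mod m\<close> is \<open>m\<close> times the
  ceiling of \<open>coord l / m\<close>. Hence both monomials on the right have coefficients of
  degree zero.\<close>

lemma S_xpow:
  "S (xpow l) = ((1 - const v) * u (- (coord l + (- coord l) mod m)) * xpow l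
    - const v * const (g (Q a * (1 - coord l))) * (1 - u m) / u m
      * xpow (l - (coord l - 1) *\<^sub>Z a)) / (1 - const v * u m)"
proof -
  have "xpow (s l) = xpow l * u (- coord l)"
    by (simp add: s_eq xpow_minus_root)
  then have *: "S (xpow l) = xpow l * u (- coord l) * factor (coord l)"
    using S_homogeneous[OF grade_zero_one, of l] by (simp add: perm_simps)
  have 1: "u (- coord l) * u (- ((- coord l) mod m)) = u (- (coord l + (- coord l) mod m))"
    by (simp flip: u_add)
  have "xpow (l - (coord l - 1) *\<^sub>Z a) = xpow l * u (- (coord l - 1))"
    by (rule xpow_minus_root)
  moreover have "u (- (coord l - 1)) / u m = u (- coord l) * u (1 - m)"
  proof -
    have "u (- (coord l - 1)) / u m = u (- (coord l - 1)) * u (- m)" by (simp add: u_minus)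
    then show ?thesis by (simp add: algebra_simps flip: u_add)
  qed
  ultimately have 2: "xpow (l - (coord l - 1) *\<^sub>Z a) / u m = xpow l * (u (- coord l) * u (1 - m))"
    by (metis times_divide_eq_right)
  have 3: "c * (1 - u m) / u m * xpow (l - (coord l - 1) *\<^sub>Z a)
      = c * (1 - u m) * (xpow l * (u (- coord l) * u (1 - m)))" for c
    by (simp flip: 2)
  show ?thesis
    unfolding * factor_def 1[symmetric] 3
    by (simp add: algebra_simps)
qed

lemma perm_one_minus_const_u: "perm_act s (1 - const c * u m) = (u m - const c) / u m"
  by (simp add: perm_simps perm_u u_minus field_simps)

lemma u_neq_const: "u m \<noteq> const v"
proof
  assume "u m = const v"
  then have "const (inverse v) * u m = const (inverse v * v)" by (simp add: const_mult)
  with v const_u_neq_1 show False by simp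
qed

text \<open>If \<open>m\<close> divides \<open>coord l - 1\<close>, the two monomials in \<open>S_xpow\<close> differ by a power of \<open>u m\<close>
  and \<open>S (xpow l)\<close> is a single term.\<close>

lemma S_involution_xpow_special:
  assumes "m dvd coord l - 1"
  shows "S (S (xpow l)) = xpow l"
proof -
  from assms obtain k where k: "coord l = 1 + m * k" by (metis diff_eq_eq add.commute dvdE)
  have "(- coord l) mod m = (m - 1) mod m"
  proof -
    have "- coord l = m - 1 + m * (- k - 1)" by (simp add: k algebra_simps)
    then show ?thesis by (metis mod_mult_self2)
  qed
  also have "\<dots> = m - 1" using m_pos by (intro mod_pos_pos_trivial) simp_all
  finally have e: "coord l + (- coord l) mod m = m * (k + 1)" by (simp add: k algebra_simps)
  have "n dvd Q a * (1 - coord l)" by (simp add: dvd_root_mult_iff k)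
  then have G: "g (Q a * (1 - coord l)) = -1" using g_cong[of _ 0] g0 by simp
  have 1: "xpow (l - (coord l - 1) *\<^sub>Z a) = u (- (m * (k + 1))) * u m * xpow l"
    by (simp add: xpow_minus_root k algebra_simps flip: u_add)
  have V: "1 - const v * u m \<noteq> 0" using const_u_neq_1[of v] by simp
  \<comment> \<open>As \<open>g\<close> takes the value -1, the bracket becomes
    \<open>(1 - v) + v * (1 - X)\<close> with \<open>X = u m\<close>, which cancels the
    denominator.\<close>
  have "S (xpow l) = u (- (m * (k + 1))) * xpow l"
    unfolding S_xpow e 1 G using V by (simp add: const_minus field_simps)
  moreover have "S (u (m * (- (k + 1))) * xpow l) = u (m * (k + 1)) * S (xpow l)"
    using S_mult[OF grade_zero_u[of "- (k + 1)"]] by (simp add: perm_u algebra_simps)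
  ultimately have "S (S (xpow l)) = u (m * (k + 1)) * u (- (m * (k + 1))) * xpow l"
    by (simp only: mult.assoc mult_minus_right)
  then show ?thesis by (simp flip: u_add)
qed

text \<open>The left side is \<open>m\<close> times the sum of the ceilings of \<open>t / m\<close>
  and \<open>(2 - t) / m\<close>; unless \<open>t\<close> is 1 mod \<open>m\<close>, that sum is
  1.\<close>

lemma ceiling_identity:
  assumes "\<not> m dvd t - 1"
  shows "(t + (- t) mod m) + ((2 - t) + (- (2 - t)) mod m) = m"
proof -
  define j where "j = (- t) mod m"
  have "m \<noteq> 1" using assms by auto
  have j: "0 \<le> j" "j < m" using m_pos by (simp_all add: j_def)
  \<comment> \<open>Remainder \<open>m - 1\<close> is the excluded case; otherwise
    \<open>m - 2 - j\<close> is itself a valid remainder.\<close>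
  have "j \<noteq> m - 1"
  proof
    assume "j = m - 1"
    moreover have "m dvd - t - j" unfolding j_def by (rule dvd_minus_mod)
    ultimately have "m dvd (- t - (m - 1)) + m" by (metis dvd_add dvd_refl)
    then have "m dvd - (t - 1)" by (simp add: algebra_simps)
    with assms show False by (simp only: dvd_minus_iff)
  qed
  have "(- (2 - t)) mod m = (m - 2 - j) mod m"
  proof -
    have "m dvd - (- t - j)" unfolding j_def by (simp only: dvd_minus_iff dvd_minus_mod)
    then have "m dvd j + t" by (simp add: algebra_simps)
    then show ?thesis by (simp add: mod_eq_dvd_iff algebra_simps)
  qed
  also have "\<dots> = m - 2 - j" using j \<open>j \<noteq> m - 1\<close> by simp
  finally show ?thesis by (simp add: j_def)
qed

text \<open>Passing from \<open>l\<close> to \<open>l'\<close> turns \<open>t\<close> into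
  \<open>2 - t\<close>, and a second passage returns to \<open>l\<close>. So \<open>S\<close> acts
  on the two monomials by a semilinear 2 by 2 matrix, and \<open>V * G * G' = 1\<close> makes its
  square trivial.\<close>

lemma S_involution_xpow_generic:
  assumes "\<not> m dvd coord l - 1"
  shows "S (S (xpow l)) = xpow l"
proof -
  define t where "t = coord l"
  define l' where "l' = l - (t - 1) *\<^sub>Z a"
  have t': "coord l' = 2 - t" by (simp add: l'_def coord_diff coord_root t_def)
  have l'': "l' - (1 - t) *\<^sub>Z a = l"
    by (simp add: l'_def zscale_diff zscale_add_left[of 1 1, simplified])
  define X Y V G G' where "X = u m" and "Y = u (t + (- t) mod m)" and "V = (const v :: 'l ratfun)"
    and "G = (const (g (Q a * (1 - t))) :: 'l ratfun)" and "G' = (const (g (Q a * (t - 1))) :: 'l ratfun)"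
  note defs = X_def Y_def G_def G'_def V_def
  define Z W where "Z = 1 - V * X" and "W = X - V"
  have nz: "X \<noteq> 0" "Y \<noteq> 0" "Z \<noteq> 0" "W \<noteq> 0"
    using const_u_neq_1[of v] u_neq_const by (simp_all add: defs Z_def W_def)
  have perm_XY: "perm_act s X = 1 / X" "perm_act s Y = 1 / Y"
    unfolding defs perm_u u_minus by (rule refl)+
  have perm_ZVG: "perm_act s Z = W / X" "perm_act s V = V" "perm_act s G = G"
    unfolding defs Z_def W_def perm_one_minus_const_u by (simp_all only: perm_simps)
  note perm = perm_XY perm_ZVG
  have "\<not> n dvd Q a * (1 - t)"
    using assms by (metis dvd_root_mult_iff dvd_minus_iff minus_diff_eq t_def)
  from g_opposite[OF this] have "v * g (Q a * (1 - t)) * g (Q a * (t - 1)) = 1"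
    by (simp add: algebra_simps)
  then have VGG: "V * G * G' = 1" unfolding defs by (metis const_mult const_one)
  \<comment> \<open>The ceiling identity expresses the power of \<open>u\<close> belonging to
    \<open>l'\<close> through that of \<open>l\<close>.\<close>
  have "u (- ((2 - t) + (- (2 - t)) mod m)) = u (t + (- t) mod m + (- m))"
    using ceiling_identity[of t] assms by (intro arg_cong[where f = u]) (simp add: t_def)
  also have "\<dots> = Y / X" by (simp only: u_add[of _ "- m"] u_minus[of m] defs) simp
  finally have Sl': "S (xpow l')
      = ((1 - V) * (Y / X) * xpow l' - V * G' * (1 - X) / X * xpow l) / Z"
    using S_xpow[of l'] unfolding t' defs Z_def by (simp add: l'')
  have Sl: "S (xpow l) = ((1 - V) / Y * xpow l - V * G * (1 - X) / X * xpow l') / Z"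
    using S_xpow[of l] unfolding defs Z_def l'_def t_def u_minus by simp
  \<comment> \<open>Coefficients of degree zero, to which semilinearity of \<open>S\<close>
    applies.\<close>
  define A B where "A = (1 - V) / (Y * Z)" and "B = V * G * (X - 1) / (X * Z)"
  have "S (xpow l) = A * xpow l + B * xpow l'"
    unfolding Sl A_def B_def using nz by (simp add: field_simps)
  moreover have "m dvd t + (- t) mod m"
  proof -
    have "m dvd - (- t - (- t) mod m)" by (simp only: dvd_minus_iff dvd_minus_mod)
    then show ?thesis by (simp add: algebra_simps)
  qed
  then have Y: "grade_zero L Y" unfolding defs using grade_zero_u by (metis dvdE)
  have "grade_zero L A" "grade_zero L B"
    unfolding A_def B_def Z_def X_def V_def G_def by (intro grade_zero_intros Y)+
  ultimately have "S (S (xpow l)) = perm_act s A * S (xpow l) + perm_act s B * S (xpow l')"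
    by (simp add: S_add S_mult)
  also have "perm_act s A = (1 - V) * Y * X / W"
    by (simp add: A_def perm_simps perm)
  also have "perm_act s B = V * G * (1 - X) * X / W"
    using nz by (simp add: B_def perm_simps perm field_simps)
  \<comment> \<open>The two contributions to \<open>xpow l'\<close> cancel.\<close>
  also have "(1 - V) * Y * X / W * S (xpow l) + V * G * (1 - X) * X / W * S (xpow l')
      = (((1 - V)\<^sup>2 * X - V * (V * G * G') * (1 - X)\<^sup>2) * xpow l) / (W * Z)"
    unfolding Sl Sl' using nz by (simp add: field_simps power2_eq_square)
  also have "(1 - V)\<^sup>2 * X - V * (V * G * G') * (1 - X)\<^sup>2 = W * Z"
    unfolding VGG Z_def W_def by (simp add: algebra_simps power2_eq_square)
  finally show ?thesis using nz by simp
qed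

lemma S_involution_xpow: "S (S (xpow l)) = xpow l"
  using S_involution_xpow_special S_involution_xpow_generic by blast

lemma S_involution: "S (S f) = f"
proof (induction f rule: homogeneous_induct)
  case (add f g)
  then show ?case by (simp add: S_add)
next
  case (homogeneous l h)
  \<comment> \<open>The permutation action hits \<open>h\<close> twice, which is trivial; in
    between, \<open>h\<close> stays of degree zero.\<close>
  have "S (S (h * xpow l)) = h * xpow l"
    using homogeneous by (simp add: S_mult grade_zero_perm S_involution_xpow perm_involution)
  then show ?case by (simp add: mult.commute)
qed

subsection \<open>Quadratic relations\<close>

definition D :: "'l ratfun \<Rightarrow> 'l ratfun"
  where "D = demazure n v g Q L s a"

lemma D_eq: "D f = (f - u m * S f) / (1 - u m)"
  by (simp add: D_def demazure_def S_def u_def m_def Let_def)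

lemma S_diff: "S (f - f') = S f - S f'"
  using S_add[of "f - f'" f'] by simp

text \<open>Applying \<open>S\<close> inverts \<open>u m\<close> and swaps \<open>f\<close> with
  \<open>S f\<close>; numerator and denominator of \<open>D f\<close> both pick up the factor
  \<open>- 1 / u m\<close>.\<close>

lemma S_D: "S (D f) = D f"
proof -
  have nz: "1 - u m \<noteq> 0" "u m - 1 \<noteq> 0" using u_neq_1 by auto
  have "grade_zero L (1 / (1 - u m))" "grade_zero L (u m)"
    by (intro grade_zero_intros)+
  then have "S (1 / (1 - u m) * (f - u m * S f))
      = perm_act s (1 / (1 - u m)) * (S f - perm_act s (u m) * f)"
    by (simp only: S_mult S_diff S_involution)
  also have "\<dots> = D f"
    using nz by (simp add: D_eq perm_simps perm_u u_minus field_simps)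
  finally show ?thesis by (simp add: D_eq)
qed

text \<open>\<open>D\<close> fixes every \<open>S\<close>-invariant element, and \<open>D f\<close>
  is one.\<close>

lemma D_idem: "D (D f) = D f"
proof -
  have "D (D f) = (1 - u m) * D f / (1 - u m)"
    by (simp add: D_eq[of "D f"] S_D left_diff_distrib)
  then show ?thesis using u_neq_1 by simp
qed

text \<open>By invariance of \<open>D f\<close> this comes down to
  \<open>(1 - v * X) - (X - v) = (1 + v) * (1 - X)\<close> with \<open>X = u m\<close>.\<close>

lemma D_mult_D: "D ((1 - const v * u m) * D f) = (1 + const v) * D f"
proof -
  have "S ((1 - const v * u m) * D f) = (u m - const v) / u m * D f"
    by (simp only: S_mult[OF grade_zero_one_minus] S_D perm_one_minus_const_u)
  then have "u m * S ((1 - const v * u m) * D f) = (u m - const v) * D f"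
    by simp
  then have "D ((1 - const v * u m) * D f)
      = ((1 - const v * u m) * D f - (u m - const v) * D f) / (1 - u m)"
    by (simp only: D_eq[of "(1 - const v * u m) * D f"])
  also have "\<dots> = (1 + const v) * D f * (1 - u m) / (1 - u m)"
    by (simp add: algebra_simps)
  finally have "D ((1 - const v * u m) * D f) = (1 + const v) * D f * (1 - u m) / (1 - u m)" .
  then show ?thesis using u_neq_1 by simp
qed

lemma D_diff: "D (f - f') = D f - D f'"
  by (simp add: D_eq S_diff algebra_simps flip: diff_divide_distrib)

definition T :: "'l ratfun \<Rightarrow> 'l ratfun"
  where "T = demazure_lusztig n v g Q L s a"

lemma T_eq: "T f = (1 - const v * u m) * D f - f"
  by (simp add: T_def D_def demazure_lusztig_def u_def m_def)

text \<open>\<open>D (T f) = (1 + v) * D f - D f\<close>, so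
  \<open>T (T f) = v * (T f + f) - T f\<close>.\<close>

lemma T_quadratic: "T (T f) = const (v - 1) * T f + const v * f"
proof -
  have "D (T f) = const v * D f"
    unfolding T_eq D_diff D_mult_D by (simp add: algebra_simps)
  then show ?thesis
    unfolding T_eq[of "T f"] by (simp add: T_eq const_diff algebra_simps)
qed

end

theorem proposition5:
  fixes \<Phi> :: "'e::euclidean_space set" and \<alpha> :: "nat \<Rightarrow> 'e" and r :: nat
    and \<iota> :: "'e \<Rightarrow> 'l::free_ab_group" and act :: "('e \<Rightarrow> 'e) \<Rightarrow> 'l \<Rightarrow> 'l"
    and Q :: "'l \<Rightarrow> int" and n :: int and v :: complex and g :: "int \<Rightarrow> complex" and i :: nat
  assumes "root_system \<Phi>" and "reduced_roots \<Phi>" and "irreducible_roots \<Phi>"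
    and "r = DIM('e)" and "simple_roots \<Phi> r \<alpha>"
    and "lattice_contains_roots \<Phi> \<iota>" and "weyl_action \<Phi> \<iota> act"
    and "quadratic_form Q"
    and "\<forall>w\<in>weyl_group \<Phi>. \<forall>l. Q (act w l) = Q l"
    and "\<forall>b\<in>\<Phi>. Q (\<iota> b) \<noteq> 0"
    and "\<forall>j\<in>{1..r}. \<forall>l. Q (\<iota> (\<alpha> j)) dvd polar Q l (\<iota> (\<alpha> j))
      \<and> act (reflection (\<alpha> j)) l = l - (polar Q l (\<iota> (\<alpha> j)) div Q (\<iota> (\<alpha> j))) *\<^sub>Z \<iota> (\<alpha> j)"
    and "1 \<le> n"
    and "v \<noteq> 0" and "\<forall>j. g j \<noteq> 0" and "\<forall>j. g (j mod n) = g j" and "g 0 = -1"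
    and "\<forall>j\<in>{1..n-1}. g j * g (n - j) = inverse v"
    and "i \<in> {1..r}"
  shows "let L = sublattice0 n Q ((\<lambda>j. \<iota> (\<alpha> j)) ` {1..r});
             D = demazure n v g Q L (act (reflection (\<alpha> i))) (\<iota> (\<alpha> i));
             T = demazure_lusztig n v g Q L (act (reflection (\<alpha> i))) (\<iota> (\<alpha> i))
         in (\<forall>f. D (D f) = D f) \<and> (\<forall>f. T (T f) = const (v - 1) * T f + const v * f)"
proof -
  let ?J = "(\<lambda>j. \<iota> (\<alpha> j)) ` {1..r}"
  have root: "\<alpha> i \<in> \<Phi>"
    using \<open>simple_roots \<Phi> r \<alpha>\<close> \<open>i \<in> {1..r}\<close> by (auto simp: simple_roots_def)
  \<comment> \<open>The reflection is in the i-th simple root alone, while the grading comes from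
    all simple roots.\<close>
  interpret metaplectic_reflection n v g Q ?J "sublattice0 n Q ?J" "\<iota> (\<alpha> i)"
    "act (reflection (\<alpha> i))"
  proof
    show "\<iota> (\<alpha> i) \<in> ?J" using \<open>i \<in> {1..r}\<close> by blast
    show "Q (\<iota> (\<alpha> i)) \<noteq> 0" using assms(10) root by blast
    show "Q (\<iota> (\<alpha> i)) dvd polar Q l (\<iota> (\<alpha> i))"
      "act (reflection (\<alpha> i)) l = l - (polar Q l (\<iota> (\<alpha> i)) div Q (\<iota> (\<alpha> i))) *\<^sub>Z \<iota> (\<alpha> i)" for l
      using assms(11) \<open>i \<in> {1..r}\<close> by blast+
    show "g (j mod n) = g j" for j using assms(15) by blast
    show "g j * g (n - j) = inverse v" if "1 \<le> j" "j < n" for j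
      using assms(17) that by simp
  qed (fact assms | simp)+
  show ?thesis
    using D_idem T_quadratic unfolding Let_def D_def T_def by blast
qed

end
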